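(* Let $\mathcal{X}\subset\mathbb{R}^n$ and $\mathcal{U}\subset\mathbb{R}^m$ be compact sets, let $\mathbb{P}$ be a probability distribution supported on $\mathcal{U}$, let $\alpha\in(0,1)$, and let $f_i:\mathcal{X}\times\mathcal{U}\to\mathbb{R}$ be continuous for each $i\in\{1,\dots,n\}$. Let $F$ be the map with components $F_i(x)=\mathrm{CVaR}^{\mathbb{P}}_\alpha[f_i(x,u)]$, and, for i.i.d. samples $\hat u^1,\hat u^2,\dots$ from $\mathbb{P}$ and $N\in\mathbb{N}$, let $\hat F^N$ be the map with components $\hat F^N_i(x)=\widehat{\mathrm{CVaR}}^N_\alpha[f_i(x,u)]$ built from the first $N$ samples. Let $\mathcal{S}=\mathrm{SOL}(\mathcal{X},F)$ and $\hat{\mathcal{S}}^N=\mathrm{SOL}(\mathcal{X},\hat F^N)$. Then, almost surely, $$\mathbb{D}(\hat{\mathcal{S}}^N,\mathcal{S})\to 0\quad\text{as } N\to\infty.$$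
   Context: Notation: $[v]_+=\max\{0,v\}$; $\|\cdot\|$ is the Euclidean norm. CVaR: $\mathrm{CVaR}_\alpha^{\mathbb{P}}[f_i(x,u)]=\inf_{t\in\mathbb{R}}\{t+\frac1\alpha\mathbb{E}_{\mathbb{P}}[f_i(x,u)-t]_+\}$, where $\mathbb{E}_{\mathbb{P}}$ is the expectation when $u$ has distribution $\mathbb{P}$. Empirical CVaR: $\widehat{\mathrm{CVaR}}^N_\alpha[f_i(x,u)]=\inf_{t\in\mathbb{R}}\{t+\frac1{N\alpha}\sum_{j=1}^N[f_i(x,\hat u^j)-t]_+\}$. Variational inequality: for a map $G:\mathcal{X}\to\mathbb{R}^n$, $\mathrm{SOL}(\mathcal{X},G)$ is the set of $x^*\in\mathcal{X}$ such that $(x-x^* )^\top G(x^* )\ge 0$ for all $x\in\mathcal{X}$. Deviation of sets: $\mathbb{D}(\mathcal{A},\mathcal{B})=\sup_{y\in\mathcal{A}}\mathrm{dist}(y,\mathcal{B})$, with $\mathrm{dist}(y,\mathcal{B})=\inf_{z\in\mathcal{B}}\|y-z\|$. *)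

theory Defs
  imports "HOL-Probability.Probability"
begin

definition CVaR :: "real \<Rightarrow> 'u measure \<Rightarrow> ('u \<Rightarrow> real) \<Rightarrow> real" where
  "CVaR \<alpha> P g = (INF t. t + (1 / \<alpha>) * (LINT u|P. max 0 (g u - t)))"

text \<open>The first \<open>N\<close> samples are \<open>s 0, \<dots>, s (N - 1)\<close>. For \<open>N = 0\<close> the infimum is over a set
  that is unbounded below, so the value carries no meaning.\<close>

definition empirical_CVaR :: "real \<Rightarrow> nat \<Rightarrow> (nat \<Rightarrow> 'u) \<Rightarrow> ('u \<Rightarrow> real) \<Rightarrow> real" where
  "empirical_CVaR \<alpha> N s g = (INF t. t + (1 / (real N * \<alpha>)) * (\<Sum>j<N. max 0 (g (s j) - t)))"

definition VI_SOL :: "'a::real_inner set \<Rightarrow> ('a \<Rightarrow> 'a) \<Rightarrow> 'a set" where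
  "VI_SOL X G = {x' \<in> X. \<forall>x\<in>X. (x - x') \<bullet> G x' \<ge> 0}"

text \<open>Distances and deviations live in \<open>[0, \<infinity>]\<close>, because solution sets may be empty:
  \<open>set_deviation {} B = 0\<close>, and \<open>set_deviation A {} = \<infinity>\<close> for nonempty \<open>A\<close>.
  In contrast, \<^const>\<open>infdist\<close> to the empty set is \<open>0\<close>.\<close>

definition set_dist :: "'a::real_normed_vector \<Rightarrow> 'a set \<Rightarrow> ennreal" where
  "set_dist y B = (INF z\<in>B. ennreal (norm (y - z)))"

definition set_deviation :: "'a::real_normed_vector set \<Rightarrow> 'a set \<Rightarrow> ennreal" where
  "set_deviation A B = (SUP y\<in>A. set_dist y B)"

text \<open>A cost \<open>f i x\<close> is constrained on \<open>U\<close> only; its values elsewhere are junk and need not even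
  be measurable. The distribution \<open>P\<close> is therefore restricted to \<open>U\<close>, a set of full measure,
  before the expectation is taken.\<close>

definition CVaR_map ::
  "real \<Rightarrow> (real^'m) measure \<Rightarrow> (real^'m) set \<Rightarrow> ('n \<Rightarrow> real^'n \<Rightarrow> real^'m \<Rightarrow> real)
    \<Rightarrow> real^'n \<Rightarrow> real^'n" where
  "CVaR_map \<alpha> P U f x = (\<chi> i. CVaR \<alpha> (restrict_space P U) (f i x))"

definition empirical_CVaR_map ::
  "real \<Rightarrow> nat \<Rightarrow> (nat \<Rightarrow> real^'m) \<Rightarrow> ('n \<Rightarrow> real^'n \<Rightarrow> real^'m \<Rightarrow> real)
    \<Rightarrow> real^'n \<Rightarrow> real^'n" where
  "empirical_CVaR_map \<alpha> N s f x = (\<chi> i. empirical_CVaR \<alpha> N s (f i x))"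

end

(*
  The map (x, t) |-> max 0 (f x u - t) is equicontinuous on X x [-B, B] over u in U, where
  B bounds |f|, so Hoeffding's inequality and Borel-Cantelli on a countable dense set of parameters
  give, almost surely, convergence of the sample means uniformly over X x [-B, B]. Thresholds t
  outside [-B, B] play no role, so taking infima over t yields uniform convergence of the empirical
  CVaR maps on X.
  A limit point of solutions for the empirical maps then solves the limiting variational
  inequality, and compactness of X turns this into convergence of the deviation. If the limiting
  solution set is empty, the same argument shows that the empirical ones are eventually empty.
*)

theory Submission
  imports Defs
begin

section \<open>Strong law for bounded i.i.d. variables\<close>

text \<open>Hoeffding's inequality makes the probability of a deviation of size \<open>e\<close>
  decay geometrically in \<open>N\<close>. These probabilities are summable, so Borel-Cantelli rules
  out infinitely many such deviations almost surely.\<close>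

lemma (in prob_space) strong_law_bounded:
  fixes Y :: "nat \<Rightarrow> 'a \<Rightarrow> real"
  assumes indep: "indep_vars (\<lambda>_. borel) Y UNIV"
    and law: "\<And>j. distr M borel (Y j) = distr M borel (Y 0)"
    and bounded: "AE \<omega> in M. \<bar>Y 0 \<omega>\<bar> \<le> B"
  shows "AE \<omega> in M. (\<lambda>N. (\<Sum>j<N. Y j \<omega>) / real N) \<longlonglongrightarrow> expectation (Y 0)"
proof -
  define \<mu> where "\<mu> = expectation (Y 0)"
  \<comment> \<open>The \<open>+ 1\<close> keeps the interval \<open>[-C, C]\<close> nondegenerate
    even for \<open>B = 0\<close>, so the denominator in Hoeffding's exponent is positive.\<close>
  define C where "C = \<bar>B\<bar> + 1"
  have C: "C > 0" unfolding C_def by simp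
  have rv [measurable]: "random_variable borel (Y j)" for j
    using indep unfolding indep_vars_def by blast
  have Hoeffding: "prob {\<omega>\<in>space M. \<bar>(\<Sum>j<N. Y j \<omega>) / real N - \<mu>\<bar> \<ge> e}
      \<le> 2 * exp (- 2 * real N * e\<^sup>2 / (C - - C)\<^sup>2)" if "N > 0" "e > 0" for N and e :: real
  proof -
    interpret Hoeffding_ineq_iid M "{..<N}" Y "Y 0" "- C" C \<mu>
    proof unfold_locales
      show "indep_vars (\<lambda>_. borel) Y {..<N}"
        using indep by (rule indep_vars_subset) auto
      show "AE x in M. Y 0 x \<in> {- C..C}"
        using bounded by eventually_elim (auto simp: C_def)
    qed (use law \<mu>_def in auto)
    show ?thesis
      using Hoeffding_ineq_abs_ge'[of e] that C by (auto simp: lessThan_empty_iff)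
  qed
  have close: "AE \<omega> in M. eventually (\<lambda>N. \<bar>(\<Sum>j<N. Y j \<omega>) / real N - \<mu>\<bar> < e) sequentially"
    if e: "e > 0" for e :: real
  proof -
    define A where "A N = {\<omega>\<in>space M. \<bar>(\<Sum>j<N. Y j \<omega>) / real N - \<mu>\<bar> \<ge> e}" for N
    define q where "q = exp (- 2 * e\<^sup>2 / (C - - C)\<^sup>2)"
    have q: "0 \<le> q" "q < 1"
      using e C by (auto simp: q_def)
    have tail: "norm (prob (A N)) \<le> 2 * q ^ N" if "N \<ge> 1" for N
    proof -
      have "exp (- 2 * real N * e\<^sup>2 / (C - - C)\<^sup>2) = q ^ N"
        unfolding q_def exp_of_nat_mult[symmetric] by (simp add: field_simps)
      then show ?thesis
        using Hoeffding[of N e] that e by (simp add: A_def)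
    qed
    have "summable (\<lambda>N. 2 * q ^ N)"
      using q by (intro summable_mult summable_geometric) simp
    then have "summable (\<lambda>N. prob (A N))"
      using tail by (rule summable_comparison_test')
    then have "AE \<omega> in M. eventually (\<lambda>N. \<omega> \<in> space M - A N) sequentially"
      by (intro borel_cantelli_AE1) (auto simp: A_def emeasure_eq_measure)
    then show ?thesis
      by eventually_elim (auto simp: A_def elim!: eventually_mono)
  qed
  \<comment> \<open>The null set of \<open>close\<close> depends on the tolerance. The countable
    family of tolerances \<open>1 / Suc k\<close> gives one null set for all of them and still
    detects convergence.\<close>
  have "AE \<omega> in M. \<forall>k. eventually
      (\<lambda>N. \<bar>(\<Sum>j<N. Y j \<omega>) / real N - \<mu>\<bar> < 1 / real (Suc k)) sequentially"
    unfolding AE_all_countable by (intro allI close) simp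
  then show ?thesis
  proof eventually_elim
    case (elim \<omega>)
    show ?case
      unfolding \<mu>_def[symmetric]
    proof (rule tendstoI)
      fix e :: real assume "e > 0"
      then obtain k where k: "1 / real (Suc k) < e"
        using reals_Archimedean by (auto simp: inverse_eq_divide)
      show "eventually (\<lambda>N. dist ((\<Sum>j<N. Y j \<omega>) / real N) \<mu> < e) sequentially"
        using elim[rule_format, of k] by eventually_elim (use k in \<open>auto simp: dist_real_def\<close>)
    qed
  qed
qed

section \<open>Uniform law of large numbers over a compact parameter set\<close>

text \<open>Compactness yields a finite \<open>\<delta>\<close>-net of \<open>K\<close> with centres
  in \<open>D\<close>. At finitely many centres pointwise convergence is simultaneous, and
  equicontinuity carries it to any \<open>x\<close> through its nearby centre: three errors of at
  most \<open>e / 4\<close> stay below \<open>e\<close>.\<close>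

lemma uniform_limit_equicontinuous_dense:
  fixes \<phi> :: "nat \<Rightarrow> 'k::metric_space \<Rightarrow> real"
  assumes K: "compact K" and D: "D \<subseteq> K" "K \<subseteq> closure D"
    and equi: "\<And>e. e > 0 \<Longrightarrow> \<exists>\<delta>>0. \<forall>x\<in>K. \<forall>y\<in>K. dist x y < \<delta> \<longrightarrow>
      (\<forall>N. \<bar>\<phi> N x - \<phi> N y\<bar> \<le> e) \<and> \<bar>\<psi> x - \<psi> y\<bar> \<le> e"
    and lim: "\<And>d. d \<in> D \<Longrightarrow> (\<lambda>N. \<phi> N d) \<longlonglongrightarrow> \<psi> d"
  shows "uniform_limit K \<phi> \<psi> sequentially"
proof (rule uniform_limitI)
  fix e :: real assume "e > 0"
  then obtain \<delta> where \<delta>: "\<delta> > 0"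
    and near: "\<And>x y N. \<lbrakk>x \<in> K; y \<in> K; dist x y < \<delta>\<rbrakk> \<Longrightarrow> \<bar>\<phi> N x - \<phi> N y\<bar> \<le> e / 4"
      "\<And>x y. \<lbrakk>x \<in> K; y \<in> K; dist x y < \<delta>\<rbrakk> \<Longrightarrow> \<bar>\<psi> x - \<psi> y\<bar> \<le> e / 4"
    using equi[of "e / 4"] by (auto simp: divide_pos_pos)
  have "K \<subseteq> (\<Union>d\<in>D. ball d \<delta>)"
    using D(2) \<delta> by (fastforce simp: closure_approachable)
  then obtain T where T: "T \<subseteq> D" "finite T" "K \<subseteq> (\<Union>d\<in>T. ball d \<delta>)"
    using compactE_image[OF K, of D "\<lambda>d. ball d \<delta>"] by auto
  have "\<forall>\<^sub>F N in sequentially. dist (\<phi> N d) (\<psi> d) < e / 4" if "d \<in> T" for d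
    using lim[of d] T(1) that \<open>e > 0\<close> by (intro tendstoD) auto
  then have "\<forall>\<^sub>F N in sequentially. \<forall>d\<in>T. dist (\<phi> N d) (\<psi> d) < e / 4"
    using T(2) by (simp add: eventually_ball_finite)
  then show "\<forall>\<^sub>F N in sequentially. \<forall>x\<in>K. dist (\<phi> N x) (\<psi> x) < e"
  proof (eventually_elim, intro ballI)
    fix N x assume net: "\<forall>d\<in>T. dist (\<phi> N d) (\<psi> d) < e / 4" and x: "x \<in> K"
    obtain d where d: "d \<in> T" "dist x d < \<delta>"
      using T(3) x by (auto simp: dist_commute)
    have "\<bar>\<phi> N x - \<phi> N d\<bar> \<le> e / 4" "\<bar>\<psi> x - \<psi> d\<bar> \<le> e / 4"
      using near[of x d] x d T(1) D(1) by auto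
    moreover have "dist (\<phi> N d) (\<psi> d) < e / 4"
      using net d by blast
    ultimately show "dist (\<phi> N x) (\<psi> x) < e"
      using \<open>e > 0\<close> unfolding dist_real_def by linarith
  qed
qed

lemma average_close:
  fixes g h :: "nat \<Rightarrow> real"
  assumes "\<And>j. \<bar>g j - h j\<bar> \<le> e" "e \<ge> 0"
  shows "\<bar>(\<Sum>j<N. g j) / real N - (\<Sum>j<N. h j) / real N\<bar> \<le> e"
proof (cases "N = 0")
  case False
  have "\<bar>(\<Sum>j<N. g j) - (\<Sum>j<N. h j)\<bar> \<le> (\<Sum>j<N. \<bar>g j - h j\<bar>)"
    unfolding sum_subtractf[symmetric] by (rule sum_abs)
  also have "\<dots> \<le> real N * e"
    using sum_bounded_above[of "{..<N}" "\<lambda>j. \<bar>g j - h j\<bar>" e] assms by simp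
  finally show ?thesis
    using False by (simp add: diff_divide_distrib[symmetric] abs_divide divide_le_eq mult.commute)
qed (use assms in simp)

lemma (in prob_space) expectation_close:
  fixes g h :: "'a \<Rightarrow> real"
  assumes "integrable M g" "integrable M h" "\<And>u. u \<in> space M \<Longrightarrow> \<bar>g u - h u\<bar> \<le> e"
  shows "\<bar>expectation g - expectation h\<bar> \<le> e"
proof -
  have "expectation g \<le> expectation (\<lambda>u. h u + e)" "expectation h \<le> expectation (\<lambda>u. g u + e)"
    by (intro integral_mono; use assms in \<open>force simp: abs_le_iff\<close>)+
  then show ?thesis
    using assms by (simp add: prob_space abs_le_iff)
qed

text \<open>The integrands are controlled on \<open>U\<close> only, so they are measurable for the
  restricted measure rather than for \<open>P\<close>. A compact \<open>U\<close> is closed, hence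
  Borel, and has full measure, so the restriction is again a probability measure.\<close>

lemma
  fixes P :: "'u::t2_space measure"
  assumes P: "prob_space P" "sets P = sets borel" "AE u in P. u \<in> U" and U: "compact U"
  shows prob_space_restrict_AE: "prob_space (restrict_space P U)"
    and space_restrict_borel: "space (restrict_space P U) = U"
    and measurable_restrict_continuous:
      "continuous_on U (h :: 'u \<Rightarrow> real) \<Longrightarrow> h \<in> borel_measurable (restrict_space P U)"
proof -
  interpret prob_space P by fact
  have "U \<in> sets P"
    using U P(2) by (simp add: compact_imp_closed borel_closed)
  then show "prob_space (restrict_space P U)"
    using emeasure_eq_1_AE[OF _ P(3)] by (intro prob_space_restrict_space)
  show "space (restrict_space P U) = U"
    using sets_eq_imp_space_eq[OF P(2)] by (simp add: space_restrict_space)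
  show "h \<in> borel_measurable (restrict_space P U)" if "continuous_on U h"
    using borel_measurable_continuous_on_restrict[OF that]
    by (simp cong: measurable_cong_sets add: sets_restrict_space_cong[OF P(2)])
qed

lemma continuous_on_section:
  assumes "continuous_on (K \<times> U) (\<lambda>(k, u). g k u)" "k \<in> K"
  shows "continuous_on U (g k)"
proof -
  have "continuous_on U ((\<lambda>(k, u). g k u) \<circ> (\<lambda>u. (k, u)))"
    using assms by (intro continuous_on_compose continuous_on_subset[OF assms(1)] continuous_intros) auto
  then show ?thesis by (simp add: o_def)
qed

lemma continuous_on_Times_bounded:
  fixes g :: "'k::topological_space \<Rightarrow> 'u::topological_space \<Rightarrow> real"
  assumes "compact K" "compact U" "continuous_on (K \<times> U) (\<lambda>(k, u). g k u)"
  obtains B where "\<And>k u. \<lbrakk>k \<in> K; u \<in> U\<rbrakk> \<Longrightarrow> \<bar>g k u\<bar> \<le> B"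
proof -
  have "compact ((\<lambda>(k, u). g k u) ` (K \<times> U))"
    using assms by (intro compact_continuous_image compact_Times)
  then show thesis
    using that compact_imp_bounded by (fastforce simp: bounded_iff)
qed

text \<open>Uniform continuity on the compact product yields a modulus in the parameter that is the
  same for all \<open>u\<close>. It therefore survives averaging over any samples in
  \<open>U\<close> and integration.\<close>

lemma uniformly_continuous_on_section:
  fixes g :: "'k::metric_space \<Rightarrow> 'u::metric_space \<Rightarrow> real"
  assumes "compact K" "compact U" "continuous_on (K \<times> U) (\<lambda>(k, u). g k u)" "e > 0"
  obtains \<delta> where "\<delta> > 0"
    "\<And>x y u. \<lbrakk>x \<in> K; y \<in> K; dist x y < \<delta>; u \<in> U\<rbrakk> \<Longrightarrow> \<bar>g x u - g y u\<bar> \<le> e"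
proof -
  have "uniformly_continuous_on (K \<times> U) (\<lambda>(k, u). g k u)"
    using assms by (intro compact_uniformly_continuous compact_Times)
  then obtain \<delta> where \<delta>: "\<delta> > 0" and *: "\<And>p q. \<lbrakk>p \<in> K \<times> U; q \<in> K \<times> U; dist q p < \<delta>\<rbrakk>
      \<Longrightarrow> dist (case q of (k, u) \<Rightarrow> g k u) (case p of (k, u) \<Rightarrow> g k u) < e"
    using \<open>e > 0\<close> by (rule uniformly_continuous_onE) blast
  have "\<bar>g x u - g y u\<bar> \<le> e" if "x \<in> K" "y \<in> K" "dist x y < \<delta>" "u \<in> U" for x y u
    using *[of "(y, u)" "(x, u)"] that by (simp add: dist_Pair_Pair dist_real_def)
  with \<delta> show thesis by (rule that)
qed

lemma (in prob_space) AE_samples_in: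
  fixes \<xi> :: "nat \<Rightarrow> 'a \<Rightarrow> 'u::t2_space"
  assumes P: "AE u in P. u \<in> U" and U: "compact U"
    and indep: "indep_vars (\<lambda>_. borel) \<xi> UNIV"
    and law: "\<And>j. distr M borel (\<xi> j) = P"
  shows "AE \<omega> in M. \<forall>j. \<xi> j \<omega> \<in> U"
  unfolding AE_all_countable
proof
  fix j
  have [measurable]: "U \<in> sets borel"
    using U by (simp add: compact_imp_closed borel_closed)
  have "random_variable borel (\<xi> j)"
    using indep unfolding indep_vars_def by blast
  then show "AE \<omega> in M. \<xi> j \<omega> \<in> U"
    using P unfolding law[of j, symmetric] by (subst (asm) AE_distr_iff) auto
qed

text \<open>The null set of the pointwise law depends on \<open>k\<close>, so that law is used only
  on a countable dense set of parameters. The modulus of continuity in \<open>k\<close> depends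
  neither on \<open>N\<close> nor on the samples, which extends the convergence to all of
  \<open>K\<close> on the same event.\<close>

theorem (in prob_space) uniform_strong_law:
  fixes K :: "'k::{metric_space, second_countable_topology} set" and U :: "'u::metric_space set"
    and g :: "'k \<Rightarrow> 'u \<Rightarrow> real" and \<xi> :: "nat \<Rightarrow> 'a \<Rightarrow> 'u"
  assumes K: "compact K" and U: "compact U"
    and g: "continuous_on (K \<times> U) (\<lambda>(k, u). g k u)"
    and P: "prob_space P" "sets P = sets borel" "AE u in P. u \<in> U"
    and indep: "indep_vars (\<lambda>_. borel) \<xi> UNIV"
    and law: "\<And>j. distr M borel (\<xi> j) = P"
  shows "AE \<omega> in M. uniform_limit K (\<lambda>N k. (\<Sum>j<N. g k (\<xi> j \<omega>)) / real N)
    (\<lambda>k. LINT u|restrict_space P U. g k u) sequentially"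
proof -
  have [measurable]: "random_variable borel (\<xi> j)" for j
    using indep unfolding indep_vars_def by blast
  have [measurable]: "U \<in> sets borel"
    using U by (simp add: compact_imp_closed borel_closed)
  interpret Q: prob_space "restrict_space P U"
    using P U by (rule prob_space_restrict_AE)
  note space_Q = space_restrict_borel[OF P U]
  obtain D where D: "countable D" "D \<subseteq> K" "K \<subseteq> closure D"
    using separable by blast
  obtain B where B: "\<And>k u. \<lbrakk>k \<in> K; u \<in> U\<rbrakk> \<Longrightarrow> \<bar>g k u\<bar> \<le> B"
    using K U g by (rule continuous_on_Times_bounded) blast
  have cont: "continuous_on U (g k)" if "k \<in> K" for k
    using g that by (rule continuous_on_section)
  have [measurable]: "g k \<in> borel_measurable (restrict_space P U)" if "k \<in> K" for k
    using measurable_restrict_continuous[OF P U cont[OF that]] .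
  have integrable: "integrable (restrict_space P U) (g k)" if "k \<in> K" for k
    using that B space_Q by (intro Q.integrable_const_bound[where B = B]) auto
  have in_U: "AE \<omega> in M. \<forall>j. \<xi> j \<omega> \<in> U"
    using P(3) U indep law by (rule AE_samples_in)
  have pointwise: "AE \<omega> in M. (\<lambda>N. (\<Sum>j<N. g k (\<xi> j \<omega>)) / real N)
      \<longlonglongrightarrow> (LINT u|restrict_space P U. g k u)" if k: "k \<in> K" for k
  proof -
    \<comment> \<open>Outside \<open>U\<close> the function \<open>g k\<close> may fail to be
      measurable. Cutting it off gives a Borel function on the whole space, which can be composed
      with the samples, and almost surely the samples never see the difference.\<close>
    define h where "h u = indicator U u *\<^sub>R g k u" for u
    have [measurable]: "h \<in> borel_measurable borel"
      unfolding h_def using cont[OF k]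
      by (intro borel_measurable_continuous_on_indicator) simp_all
    have "AE \<omega> in M. (\<lambda>N. (\<Sum>j<N. h (\<xi> j \<omega>)) / real N) \<longlonglongrightarrow> expectation (\<lambda>\<omega>. h (\<xi> 0 \<omega>))"
    proof (rule strong_law_bounded)
      show "indep_vars (\<lambda>_. borel) (\<lambda>j \<omega>. h (\<xi> j \<omega>)) UNIV"
        using indep by (rule indep_vars_compose2) simp
      show "distr M borel (\<lambda>\<omega>. h (\<xi> j \<omega>)) = distr M borel (\<lambda>\<omega>. h (\<xi> 0 \<omega>))" for j
        using distr_distr[of h borel borel "\<xi> j" M] distr_distr[of h borel borel "\<xi> 0" M]
        by (simp add: law o_def)
      show "AE \<omega> in M. \<bar>h (\<xi> 0 \<omega>)\<bar> \<le> B"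
        using in_U by eventually_elim (use B[OF k] in \<open>auto simp: h_def\<close>)
    qed
    moreover have "expectation (\<lambda>\<omega>. h (\<xi> 0 \<omega>)) = (LINT u|restrict_space P U. g k u)"
    proof -
      have "expectation (\<lambda>\<omega>. h (\<xi> 0 \<omega>)) = (LINT u|distr M borel (\<xi> 0). h u)"
        by (subst integral_distr) auto
      also have "\<dots> = (LINT u|restrict_space P U. g k u)"
        using sets_eq_imp_space_eq[OF P(2)]
        by (simp add: law integral_restrict_space h_def P(2))
      finally show ?thesis .
    qed
    ultimately have "AE \<omega> in M. (\<lambda>N. (\<Sum>j<N. h (\<xi> j \<omega>)) / real N)
        \<longlonglongrightarrow> (LINT u|restrict_space P U. g k u)"
      by simp
    then show ?thesis
      using in_U by eventually_elim (simp add: h_def)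
  qed
  have "AE \<omega> in M. \<forall>d\<in>D. (\<lambda>N. (\<Sum>j<N. g d (\<xi> j \<omega>)) / real N)
      \<longlonglongrightarrow> (LINT u|restrict_space P U. g d u)"
    using D pointwise by (subst AE_ball_countable) auto
  then show ?thesis
    using in_U
  proof eventually_elim
    case (elim \<omega>)
    show ?case
    proof (rule uniform_limit_equicontinuous_dense[OF K D(2,3)])
      fix e :: real assume e: "e > 0"
      obtain \<delta> where \<delta>: "\<delta> > 0"
        and near: "\<And>x y u. \<lbrakk>x \<in> K; y \<in> K; dist x y < \<delta>; u \<in> U\<rbrakk> \<Longrightarrow> \<bar>g x u - g y u\<bar> \<le> e"
        using K U g e by (rule uniformly_continuous_on_section) blast
      \<comment> \<open>A bound on \<open>U\<close> that is uniform in \<open>u\<close> passes to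
        the sample mean, as the samples lie in \<open>U\<close>, and to the expectation, as
        \<open>U\<close> is the whole restricted space.\<close>
      have "\<bar>(\<Sum>j<N. g x (\<xi> j \<omega>)) / real N - (\<Sum>j<N. g y (\<xi> j \<omega>)) / real N\<bar> \<le> e"
        "\<bar>(LINT u|restrict_space P U. g x u) - (LINT u|restrict_space P U. g y u)\<bar> \<le> e"
        if "x \<in> K" "y \<in> K" "dist x y < \<delta>" for x y N
        using near[OF that] elim(2) e integrable that space_Q
        by (blast intro: average_close less_imp_le, intro Q.expectation_close) simp_all
      with \<delta> show "\<exists>\<delta>>0. \<forall>x\<in>K. \<forall>y\<in>K. dist x y < \<delta> \<longrightarrow>
        (\<forall>N. \<bar>(\<Sum>j<N. g x (\<xi> j \<omega>)) / real N - (\<Sum>j<N. g y (\<xi> j \<omega>)) / real N\<bar> \<le> e) \<and>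
        \<bar>(LINT u|restrict_space P U. g x u) - (LINT u|restrict_space P U. g y u)\<bar> \<le> e"
        by blast
    qed (use elim(1) in blast)
  qed
qed

section \<open>CVaR under perturbation of the integrand or of the distribution\<close>

text \<open>Infima are 1-Lipschitz in the supremum distance. Boundedness below matters because the
  real \<open>INF\<close> of a set unbounded below is an arbitrary value.\<close>

lemma INF_close:
  fixes a b :: "'t \<Rightarrow> real"
  assumes "bdd_below (range a)" "bdd_below (range b)" "\<And>t. \<bar>a t - b t\<bar> \<le> e"
  shows "\<bar>(INF t. a t) - (INF t. b t)\<bar> \<le> e"
proof -
  have "(INF t. a t) - e \<le> b t" "(INF t. b t) - e \<le> a t" for t
    using cINF_lower[OF assms(1), of t] cINF_lower[OF assms(2), of t] assms(3)[of t] by auto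
  then have "(INF t. a t) - e \<le> (INF t. b t)" "(INF t. b t) - e \<le> (INF t. a t)"
    by (auto intro!: cINF_greatest)
  then show ?thesis by (simp add: abs_le_iff)
qed

text \<open>Here \<open>A\<close> stands for the mean excess over \<open>t\<close>, either empirical
  or exact. As \<open>1 / \<alpha>\<close> exceeds 1 and \<open>A\<close> is nonnegative, the
  objective is at least \<open>t + A\<close>. This provides the lower bound that
  \<open>INF_close\<close> asks for.\<close>

lemma CVaR_objective_ge:
  fixes t B \<alpha> A :: real
  assumes "0 < \<alpha>" "\<alpha> < 1" "0 \<le> A" "- B - t \<le> A"
  shows "- B \<le> t + (1 / \<alpha>) * A"
proof -
  have "A \<le> (1 / \<alpha>) * A"
    using assms by (simp add: le_divide_eq mult_left_le)
  then show ?thesis using assms by simp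
qed

context prob_space
begin

lemma integrable_excess:
  fixes g :: "'a \<Rightarrow> real"
  assumes "g \<in> borel_measurable M" "\<And>u. u \<in> space M \<Longrightarrow> \<bar>g u\<bar> \<le> B"
  shows "integrable M (\<lambda>u. max 0 (g u - t))"
proof (rule integrable_const_bound[where B = "B + \<bar>t\<bar>"])
  have "norm (max 0 (g u - t)) \<le> B + \<bar>t\<bar>" if "u \<in> space M" for u
    using assms(2)[OF that] by auto
  then show "AE u in M. norm (max 0 (g u - t)) \<le> B + \<bar>t\<bar>" by (rule AE_I2)
qed (use assms(1) in measurable)

lemma bdd_below_CVaR_objective:
  fixes g :: "'a \<Rightarrow> real"
  assumes g: "g \<in> borel_measurable M" "\<And>u. u \<in> space M \<Longrightarrow> \<bar>g u\<bar> \<le> B"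
    and \<alpha>: "0 < \<alpha>" "\<alpha> < 1"
  shows "bdd_below (range (\<lambda>t. t + (1 / \<alpha>) * expectation (\<lambda>u. max 0 (g u - t))))"
proof (rule bdd_belowI2[where m = "- B"])
  fix t
  have "- B - t \<le> max 0 (g u - t)" if "u \<in> space M" for u
    using g(2)[OF that] by auto
  then have "expectation (\<lambda>_. - B - t) \<le> expectation (\<lambda>u. max 0 (g u - t))"
    by (intro integral_mono integrable_excess[OF g] integrable_const)
  then show "- B \<le> t + (1 / \<alpha>) * expectation (\<lambda>u. max 0 (g u - t))"
    using \<alpha> by (intro CVaR_objective_ge) (auto simp: prob_space)
qed

text \<open>The excess \<open>max 0 (g u - t)\<close> is 1-Lipschitz in \<open>g u\<close>, so for
  every \<open>t\<close> the two objectives differ by at most \<open>e / \<alpha>\<close>.\<close>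

lemma CVaR_close:
  fixes g h :: "'a \<Rightarrow> real"
  assumes g: "g \<in> borel_measurable M" "\<And>u. u \<in> space M \<Longrightarrow> \<bar>g u\<bar> \<le> B"
    and h: "h \<in> borel_measurable M" "\<And>u. u \<in> space M \<Longrightarrow> \<bar>h u\<bar> \<le> B"
    and \<alpha>: "0 < \<alpha>" "\<alpha> < 1"
    and close: "\<And>u. u \<in> space M \<Longrightarrow> \<bar>g u - h u\<bar> \<le> e"
  shows "\<bar>CVaR \<alpha> M g - CVaR \<alpha> M h\<bar> \<le> e / \<alpha>"
  unfolding CVaR_def
proof (rule INF_close)
  fix t
  have "\<bar>max 0 (g u - t) - max 0 (h u - t)\<bar> \<le> e" if "u \<in> space M" for u
    using close[OF that] by linarith
  then have "\<bar>expectation (\<lambda>u. max 0 (g u - t)) - expectation (\<lambda>u. max 0 (h u - t))\<bar> \<le> e"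
    by (intro expectation_close integrable_excess[OF g] integrable_excess[OF h])
  then show "\<bar>t + (1 / \<alpha>) * expectation (\<lambda>u. max 0 (g u - t))
      - (t + (1 / \<alpha>) * expectation (\<lambda>u. max 0 (h u - t)))\<bar> \<le> e / \<alpha>"
    using \<alpha> by (simp add: diff_divide_distrib[symmetric] divide_right_mono)
qed (rule bdd_below_CVaR_objective; use g h \<alpha> in blast)+

text \<open>Beyond \<open>B\<close> both excess means vanish, and as \<open>t\<close> drops below \<open>-B\<close> they grow by the same
  amount, so thresholds in \<open>[-B, B]\<close> suffice.\<close>

lemma empirical_CVaR_close:
  fixes g :: "'a \<Rightarrow> real"
  assumes g: "g \<in> borel_measurable M" "\<And>u. u \<in> space M \<Longrightarrow> \<bar>g u\<bar> \<le> B"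
    and \<alpha>: "0 < \<alpha>" "\<alpha> < 1"
    and N: "N > 0" and s: "\<And>j. s j \<in> space M"
    and close: "\<And>t. t \<in> {-B..B} \<Longrightarrow>
      \<bar>(\<Sum>j<N. max 0 (g (s j) - t)) / real N - expectation (\<lambda>u. max 0 (g u - t))\<bar> \<le> e"
  shows "\<bar>empirical_CVaR \<alpha> N s g - CVaR \<alpha> M g\<bar> \<le> e / \<alpha>"
proof -
  define A where "A t = (\<Sum>j<N. max 0 (g (s j) - t)) / real N" for t
  define E where "E t = expectation (\<lambda>u. max 0 (g u - t))" for t
  \<comment> \<open>This makes \<open>[-B, B]\<close> nonempty, so \<open>close\<close> is available
    at both endpoints, to which the thresholds outside are reduced.\<close>
  have B: "B \<ge> 0" using g(2)[OF s[of 0]] by linarith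
  have gs: "- B \<le> g (s j)" "g (s j) \<le> B" for j
    using g(2)[OF s[of j]] by auto
  have "\<bar>A t - E t\<bar> \<le> e" for t
  proof -
    consider "t \<in> {-B..B}" | "t > B" | "t < - B" by force
    then show ?thesis
    proof cases
      case 1
      then show ?thesis using close by (simp add: A_def E_def)
    next
      case 2
      have "max 0 (g (s j) - t) = max 0 (g (s j) - B)" for j
        using gs[of j] 2 by auto
      moreover have "E t = E B"
        unfolding E_def by (intro Bochner_Integration.integral_cong) (use g(2) 2 in force)+
      ultimately show ?thesis using close[of B] B by (simp add: A_def E_def)
    next
      case 3
      have "max 0 (g (s j) - t) = max 0 (g (s j) - (- B)) + (- B - t)" for j
        using gs[of j] 3 by auto
      \<comment> \<open>The mean of the constant shift is the shift itself only for
        \<open>N > 0\<close>; division by zero would turn it into 0.\<close>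
      then have "A t = A (- B) + (- B - t)"
        using N by (simp add: A_def sum.distrib add_divide_distrib)
      moreover have "E t = expectation (\<lambda>u. max 0 (g u - (- B)) + (- B - t))"
        unfolding E_def by (intro Bochner_Integration.integral_cong) (use g(2) 3 in force)+
      then have "E t = E (- B) + (- B - t)"
        unfolding E_def using integrable_excess[OF g, of "- B"] by (simp add: prob_space)
      ultimately show ?thesis using close[of "- B"] B by (simp add: A_def E_def)
    qed
  qed
  then have "\<bar>t + (1 / \<alpha>) * A t - (t + (1 / \<alpha>) * E t)\<bar> \<le> e / \<alpha>" for t
    using \<alpha> by (simp add: diff_divide_distrib[symmetric] divide_right_mono)
  moreover have "bdd_below (range (\<lambda>t. t + (1 / \<alpha>) * A t))"
  proof (rule bdd_belowI2[where m = "- B"])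
    fix t
    have "(\<Sum>j<N. - B - t) \<le> (\<Sum>j<N. max 0 (g (s j) - t))"
    proof (rule sum_mono)
      show "- B - t \<le> max 0 (g (s j) - t)" for j using gs[of j] by simp
    qed
    then have "- B - t \<le> A t" "0 \<le> A t"
      using N by (auto simp: A_def le_divide_eq mult.commute intro!: divide_nonneg_nonneg sum_nonneg)
    then show "- B \<le> t + (1 / \<alpha>) * A t" using \<alpha> by (intro CVaR_objective_ge)
  qed
  moreover have "bdd_below (range (\<lambda>t. t + (1 / \<alpha>) * E t))"
    unfolding E_def using g \<alpha> by (rule bdd_below_CVaR_objective)
  ultimately have "\<bar>(INF t. t + (1 / \<alpha>) * A t) - (INF t. t + (1 / \<alpha>) * E t)\<bar> \<le> e / \<alpha>"
    by (intro INF_close)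
  then show ?thesis
    by (simp add: empirical_CVaR_def CVaR_def A_def E_def mult.commute)
qed

end

section \<open>Stability of solution sets of variational inequalities\<close>

text \<open>Otherwise there are solutions for arbitrarily late \<open>G N\<close> that stay a fixed
  distance away from \<open>VI_SOL X F\<close>. They have a limit point in \<open>X\<close>, the
  inequalities pass to the limit, and so the limit point lies in \<open>VI_SOL X F\<close>. An empty
  \<open>VI_SOL X F\<close> needs no separate case: distances to it are infinite, and the
  constructed limit point contradicts emptiness.\<close>

theorem VI_SOL_stability:
  fixes X :: "'a::real_inner set"
  assumes X: "compact X" and lim: "uniform_limit X G F sequentially" and F: "continuous_on X F"
  shows "(\<lambda>N. set_deviation (VI_SOL X (G N)) (VI_SOL X F)) \<longlonglongrightarrow> 0"
proof (rule ccontr)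
  assume "\<not> ?thesis"
  then obtain e where e: "e > 0"
    and "\<not> (\<forall>\<^sub>F N in sequentially. set_deviation (VI_SOL X (G N)) (VI_SOL X F) < e)"
    unfolding order_tendsto_iff by auto
  then have "\<exists>N\<ge>m. e \<le> set_deviation (VI_SOL X (G N)) (VI_SOL X F)" for m
    unfolding eventually_sequentially not_less[symmetric] by blast
  \<comment> \<open>The deviation is a supremum that need not be attained; a level strictly below
    \<open>e\<close> is exceeded at an actual solution.\<close>
  moreover obtain e' where e': "0 < e'" "e' < e"
    using dense[OF e] by blast
  ultimately have "\<exists>N\<ge>m. \<exists>y\<in>VI_SOL X (G N). e' < set_dist y (VI_SOL X F)" for m
    by (metis less_SUP_iff less_le_trans set_deviation_def)
  then obtain n y where n: "\<And>m. n m \<ge> m" and y: "\<And>m. y m \<in> VI_SOL X (G (n m))"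
    and far: "\<And>m. e' < set_dist (y m) (VI_SOL X F)"
    by metis
  have in_X: "\<And>m. y m \<in> X" using y by (auto simp: VI_SOL_def)
  then obtain l r where l: "l \<in> X" and r: "strict_mono r" and y_lim: "(y \<circ> r) \<longlonglongrightarrow> l"
    using X unfolding compact_def by metis
  \<comment> \<open>The indices \<open>n m\<close> need not be monotone, so \<open>n (r m)\<close>
    need not be a subsequence. Divergence to infinity, which follows from
    \<open>n m \<ge> m\<close>, is enough to transfer the limit.\<close>
  have "filterlim (\<lambda>m. n (r m)) at_top sequentially"
    using n r by (intro filterlim_at_top_mono[OF filterlim_subseq[OF r]]) auto
  then have "uniform_limit X (\<lambda>m. G (n (r m))) F sequentially"
    using lim by (rule filterlim_compose[rotated])
  \<comment> \<open>The evaluation points move with \<open>m\<close>: uniform convergence handles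
    the change of map, and continuity of \<open>F\<close> then handles the change of point.\<close>
  then have "(\<lambda>m. G (n (r m)) (y (r m)) - F (y (r m))) \<longlonglongrightarrow> 0"
    using in_X by (auto intro!: tendstoI dest!: uniform_limitD simp: dist_norm elim!: eventually_mono)
  moreover have "(\<lambda>m. F (y (r m))) \<longlonglongrightarrow> F l"
    using F y_lim in_X l by (intro continuous_on_tendsto_compose[OF F]) (auto simp: o_def)
  ultimately have "(\<lambda>m. G (n (r m)) (y (r m))) \<longlonglongrightarrow> F l"
    by (rule Lim_transform[rotated])
  then have inner_lim: "(\<lambda>m. (x - y (r m)) \<bullet> G (n (r m)) (y (r m))) \<longlonglongrightarrow> (x - l) \<bullet> F l" for x
    using y_lim by (intro tendsto_intros) (auto simp: o_def)
  have "(x - l) \<bullet> F l \<ge> 0" if "x \<in> X" for x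
    using y that by (intro tendsto_lowerbound[OF inner_lim]) (auto simp: VI_SOL_def)
  with l have "l \<in> VI_SOL X F" by (simp add: VI_SOL_def)
  then have "set_dist (y (r m)) (VI_SOL X F) \<le> ennreal (norm (y (r m) - l))" for m
    unfolding set_dist_def by (rule INF_lower)
  then have "e' \<le> ennreal (norm (y (r m) - l))" for m
    using far[of "r m"] by (meson less_imp_le order_trans)
  moreover have "(\<lambda>m. ennreal (norm (y (r m) - l))) \<longlonglongrightarrow> ennreal 0"
    using y_lim by (intro tendsto_ennrealI tendsto_norm_zero LIM_zero) (simp add: o_def)
  ultimately have "e' \<le> ennreal 0"
    by (intro tendsto_lowerbound) auto
  with e' show False by simp
qed

section \<open>Uniform convergence of the empirical CVaR and continuity of its limit\<close>

text \<open>Treating the threshold as part of the parameter makes the law of large numbers uniform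
  in \<open>x\<close> and \<open>t\<close> at once. That law needs a compact parameter set, which is
  why thresholds are truncated to \<open>[-B, B]\<close>.\<close>

theorem (in prob_space) empirical_CVaR_uniform_limit:
  fixes X :: "'k::{metric_space, second_countable_topology} set" and U :: "'u::metric_space set"
    and h :: "'k \<Rightarrow> 'u \<Rightarrow> real" and \<xi> :: "nat \<Rightarrow> 'a \<Rightarrow> 'u"
  assumes X: "compact X" and U: "compact U"
    and h: "continuous_on (X \<times> U) (\<lambda>(x, u). h x u)"
    and P: "prob_space P" "sets P = sets borel" "AE u in P. u \<in> U"
    and \<alpha>: "0 < \<alpha>" "\<alpha> < 1"
    and indep: "indep_vars (\<lambda>_. borel) \<xi> UNIV"
    and law: "\<And>j. distr M borel (\<xi> j) = P"
  shows "AE \<omega> in M. uniform_limit X (\<lambda>N x. empirical_CVaR \<alpha> N (\<lambda>j. \<xi> j \<omega>) (h x))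
    (\<lambda>x. CVaR \<alpha> (restrict_space P U) (h x)) sequentially"
proof -
  interpret Q: prob_space "restrict_space P U"
    using P U by (rule prob_space_restrict_AE)
  note space_Q = space_restrict_borel[OF P U]
  obtain B where B: "\<And>x u. \<lbrakk>x \<in> X; u \<in> U\<rbrakk> \<Longrightarrow> \<bar>h x u\<bar> \<le> B"
    using X U h by (rule continuous_on_Times_bounded) blast
  have meas: "h x \<in> borel_measurable (restrict_space P U)" if "x \<in> X" for x
    using measurable_restrict_continuous[OF P U continuous_on_section[OF h that]] .
  define K where "K = X \<times> {- B..B}"
  define g where "g = (\<lambda>(x, t) u. max 0 (h x u - t))"
  have "continuous_on (K \<times> U) ((\<lambda>(x, u). h x u) \<circ> (\<lambda>p. (fst (fst p), snd p)))"
    by (intro continuous_on_compose continuous_intros continuous_on_subset[OF h]) (auto simp: K_def)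
  then have "continuous_on (K \<times> U) (\<lambda>p. max 0 (h (fst (fst p)) (snd p) - snd (fst p)))"
    by (intro continuous_intros) (simp add: o_def)
  then have g: "continuous_on (K \<times> U) (\<lambda>(k, u). g k u)"
    by (simp add: g_def case_prod_unfold)
  have K: "compact K"
    unfolding K_def using X by (intro compact_Times) auto
  have in_U: "AE \<omega> in M. \<forall>j. \<xi> j \<omega> \<in> U"
    using P(3) U indep law by (rule AE_samples_in)
  with uniform_strong_law[OF K U g P indep law] show ?thesis
  proof eventually_elim
    case (elim \<omega>)
    show ?case
    proof (rule uniform_limitI)
      fix e :: real assume e: "e > 0"
      \<comment> \<open>\<open>empirical_CVaR_close\<close> divides by \<open>\<alpha>\<close> and
        gives a non-strict bound; the tolerance \<open>\<alpha> * (e / 2)\<close> leaves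
        \<open>e / 2 < e\<close>. The condition \<open>0 < N\<close> added below excludes the
        meaningless empirical CVaR of an empty sample.\<close>
      then have "\<forall>\<^sub>F N in sequentially. \<forall>k\<in>K. dist ((\<Sum>j<N. g k (\<xi> j \<omega>)) / real N)
          (LINT u|restrict_space P U. g k u) < \<alpha> * (e / 2)"
        using \<alpha> by (intro uniform_limitD[OF elim(1)]) simp
      then show "\<forall>\<^sub>F N in sequentially. \<forall>x\<in>X. dist (empirical_CVaR \<alpha> N (\<lambda>j. \<xi> j \<omega>) (h x))
          (CVaR \<alpha> (restrict_space P U) (h x)) < e"
        using eventually_gt_at_top[of 0]
      proof (eventually_elim, intro ballI)
        fix N :: nat and x
        assume close: "\<forall>k\<in>K. dist ((\<Sum>j<N. g k (\<xi> j \<omega>)) / real N)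
            (LINT u|restrict_space P U. g k u) < \<alpha> * (e / 2)" and "0 < N" and x: "x \<in> X"
        have "\<bar>empirical_CVaR \<alpha> N (\<lambda>j. \<xi> j \<omega>) (h x) - CVaR \<alpha> (restrict_space P U) (h x)\<bar>
            \<le> \<alpha> * (e / 2) / \<alpha>"
        proof (rule Q.empirical_CVaR_close[OF meas[OF x] _ \<alpha> \<open>0 < N\<close>])
          fix t assume "t \<in> {- B..B}"
          then have "(x, t) \<in> K" using x by (simp add: K_def)
          with close show "\<bar>(\<Sum>j<N. max 0 (h x (\<xi> j \<omega>) - t)) / real N
              - (LINT u|restrict_space P U. max 0 (h x u - t))\<bar> \<le> \<alpha> * (e / 2)"
            by (force simp: g_def dist_real_def)
        qed (use B x elim(2) space_Q in auto)
        also have "\<dots> < e" using \<alpha> e by simp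
        finally show "dist (empirical_CVaR \<alpha> N (\<lambda>j. \<xi> j \<omega>) (h x))
          (CVaR \<alpha> (restrict_space P U) (h x)) < e" by (simp add: dist_real_def)
      qed
    qed
  qed
qed

text \<open>Nearby \<open>x\<close> have costs that are uniformly close on \<open>U\<close>, and
  CVaR is Lipschitz for this distance. Continuity of the limit map is what
  \<open>VI_SOL_stability\<close> requires.\<close>

lemma continuous_on_CVaR:
  fixes X :: "'k::metric_space set" and U :: "'u::metric_space set"
    and h :: "'k \<Rightarrow> 'u \<Rightarrow> real"
  assumes X: "compact X" and U: "compact U"
    and h: "continuous_on (X \<times> U) (\<lambda>(x, u). h x u)"
    and P: "prob_space P" "sets P = sets borel" "AE u in P. u \<in> U"
    and \<alpha>: "0 < \<alpha>" "\<alpha> < 1"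
  shows "continuous_on X (\<lambda>x. CVaR \<alpha> (restrict_space P U) (h x))"
  unfolding continuous_on_iff
proof (intro ballI allI impI)
  interpret Q: prob_space "restrict_space P U"
    using P U by (rule prob_space_restrict_AE)
  note space_Q = space_restrict_borel[OF P U]
  obtain B where B: "\<And>x u. \<lbrakk>x \<in> X; u \<in> U\<rbrakk> \<Longrightarrow> \<bar>h x u\<bar> \<le> B"
    using X U h by (rule continuous_on_Times_bounded) blast
  have meas: "h x \<in> borel_measurable (restrict_space P U)" if "x \<in> X" for x
    using measurable_restrict_continuous[OF P U continuous_on_section[OF h that]] .
  fix x and e :: real assume x: "x \<in> X" and e: "0 < e"
  have "0 < \<alpha> * (e / 2)" using \<alpha> e by simp
  then obtain \<delta> where \<delta>: "\<delta> > 0" and near: "\<And>x y u. \<lbrakk>x \<in> X; y \<in> X; dist x y < \<delta>; u \<in> U\<rbrakk>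
      \<Longrightarrow> \<bar>h x u - h y u\<bar> \<le> \<alpha> * (e / 2)"
    using uniformly_continuous_on_section[OF X U h] by blast
  have "dist (CVaR \<alpha> (restrict_space P U) (h y)) (CVaR \<alpha> (restrict_space P U) (h x)) < e"
    if "y \<in> X" "dist y x < \<delta>" for y
  proof -
    have "\<bar>CVaR \<alpha> (restrict_space P U) (h y) - CVaR \<alpha> (restrict_space P U) (h x)\<bar>
        \<le> \<alpha> * (e / 2) / \<alpha>"
      using B near x that space_Q \<alpha> by (intro Q.CVaR_close[where B = B] meas) auto
    also have "\<dots> < e" using \<alpha> e by simp
    finally show ?thesis by (simp add: dist_real_def)
  qed
  with \<delta> show "\<exists>\<delta>>0. \<forall>y\<in>X. dist y x < \<delta> \<longrightarrow>
      dist (CVaR \<alpha> (restrict_space P U) (h y)) (CVaR \<alpha> (restrict_space P U) (h x)) < e"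
    by blast
qed

section \<open>Vector-valued maps and convergence of the solution sets\<close>

lemma uniform_limit_vec:
  fixes G :: "'b \<Rightarrow> 'a \<Rightarrow> real^'n"
  assumes "\<And>i. uniform_limit X (\<lambda>N x. G N x $ i) (\<lambda>x. F x $ i) \<F>"
  shows "uniform_limit X G F \<F>"
proof (rule uniform_limitI)
  fix e :: real assume e: "e > 0"
  \<comment> \<open>The Euclidean norm is at most the sum of the absolute coordinates, so each
    coordinate gets an equal share of \<open>e\<close>.\<close>
  define c where "c = e / real CARD('n)"
  have "c > 0" using e by (simp add: c_def)
  then have "\<forall>\<^sub>F N in \<F>. \<forall>x\<in>X. dist (G N x $ i) (F x $ i) < c" for i
    using assms by (rule uniform_limitD[rotated])
  then have "\<forall>\<^sub>F N in \<F>. \<forall>i. \<forall>x\<in>X. dist (G N x $ i) (F x $ i) < c"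
    by (rule eventually_all_finite)
  then show "\<forall>\<^sub>F N in \<F>. \<forall>x\<in>X. dist (G N x) (F x) < e"
  proof (eventually_elim, intro ballI)
    fix N x assume close: "\<forall>i. \<forall>x\<in>X. dist (G N x $ i) (F x $ i) < c" and "x \<in> X"
    have "dist (G N x) (F x) \<le> (\<Sum>i\<in>UNIV. \<bar>(G N x - F x) $ i\<bar>)"
      unfolding dist_norm by (rule norm_le_l1_cart)
    also have "\<dots> < (\<Sum>i\<in>(UNIV :: 'n set). c)"
      using close \<open>x \<in> X\<close> by (intro sum_strict_mono) (auto simp: dist_real_def)
    also have "\<dots> = e" by (simp add: c_def)
    finally show "dist (G N x) (F x) < e" .
  qed
qed

theorem theorem1:
  fixes X :: "(real^'n) set"
    and U :: "(real^'m) set"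
    and P :: "(real^'m) measure"
    and \<alpha> :: real
    and f :: "'n \<Rightarrow> real^'n \<Rightarrow> real^'m \<Rightarrow> real"
    and M :: "'w measure"
    and \<xi> :: "nat \<Rightarrow> 'w \<Rightarrow> real^'m"
  assumes "compact X" and "compact U"
    and "prob_space P" and "sets P = sets borel" and "AE u in P. u \<in> U"
    and "0 < \<alpha>" and "\<alpha> < 1"
    and "\<And>i. continuous_on (X \<times> U) (\<lambda>(x, u). f i x u)"
    and "prob_space M"
    and "prob_space.indep_vars M (\<lambda>_. borel) \<xi> UNIV"
    and "\<And>j. distr M borel (\<xi> j) = P"
  shows "AE \<omega> in M.
    (\<lambda>N. set_deviation (VI_SOL X (empirical_CVaR_map \<alpha> N (\<lambda>j. \<xi> j \<omega>) f))
                       (VI_SOL X (CVaR_map \<alpha> P U f)))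
      \<longlonglongrightarrow> 0"
proof -
  interpret prob_space M by fact
  note P = assms(3-5) and \<alpha> = assms(6,7)
  have F: "continuous_on X (CVaR_map \<alpha> P U f)"
    unfolding CVaR_map_def using assms(1,2,8) P \<alpha>
    by (intro continuous_on_vec_lambda continuous_on_CVaR)
  \<comment> \<open>The index type is finite, so one null set serves all components. Beyond this
    point the argument is deterministic along a fixed sample path.\<close>
  have "AE \<omega> in M. \<forall>i. uniform_limit X (\<lambda>N x. empirical_CVaR \<alpha> N (\<lambda>j. \<xi> j \<omega>) (f i x))
      (\<lambda>x. CVaR \<alpha> (restrict_space P U) (f i x)) sequentially"
    unfolding AE_all_countable
    using assms(1,2,8) P \<alpha> assms(10,11) by (intro allI empirical_CVaR_uniform_limit)
  then show ?thesis
  proof eventually_elim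
    case (elim \<omega>)
    then have "uniform_limit X (\<lambda>N. empirical_CVaR_map \<alpha> N (\<lambda>j. \<xi> j \<omega>) f) (CVaR_map \<alpha> P U f)
        sequentially"
      by (intro uniform_limit_vec) (simp add: empirical_CVaR_map_def CVaR_map_def)
    with assms(1) show ?case
      using F by (rule VI_SOL_stability)
  qed
qed

end
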